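(* The sequential eigenvalue procedure with deflation performs at most $K\le\lceil\log_2|G_K|\rceil$ accepted iterations; in particular $K\le\lceil\log_2 M!\rceil=O(M\log M)$.
   Context: $R\in\mathbb{C}^{M\times M}$ is Hermitian and $\mathcal{B}$ is a finite set of candidate generators in $\mathbb{C}^{M\times M}$. $\mathbf{P}_\sigma$ is the permutation matrix of $\sigma\in S_M$; $\langle X,Y\rangle_F=\operatorname{Tr}(X^HY)$; $\|\cdot\|_F$ is the Frobenius norm; $[X,Y]=XY-YX$; $\delta(A,R)=\|[R,A]\|_F/(\|R\|_F\|A\|_F)$. Procedure: initialize $G_0=\{e\}\le S_M$, $k=0$, with acceptance threshold $\tau\ge0$ and iteration cap $K_{\max}$. (S1) Form $\mathcal{B}^{\perp G_k}$, the Frobenius-orthogonal complement of $\operatorname{span}\{\mathbf{P}_g:g\in G_k\}$ within $\operatorname{span}(\mathcal{B})$ (so its elements are orthogonal to every $\mathbf{P}_g$, $g\in G_k$). (S2) Let $A^\ast_{k+1}\in\mathcal{B}^{\perp G_k}$, $\|A^\ast_{k+1}\|_F=1$, be a minimizer of $\|[R,A]\|_F^2/\|A\|_F^2$ over nonzero $A\in\mathcal{B}^{\perp G_k}$. (S3) Round to the nearest permutation, $\sigma^\ast_{k+1}=\arg\max_{\sigma\in S_M}\langle A^\ast_{k+1},\mathbf{P}_\sigma\rangle_F$. (S4) If $\delta(\mathbf{P}_{\sigma^\ast_{k+1}},R)>\tau$, terminate and return $G_k$. (S5) Otherwise (the iteration is accepted) set $G_{k+1}=\langle G_k,\sigma^\ast_{k+1}\rangle$,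 increment $k$, and repeat unless $k\ge K_{\max}$. $K$ is the number of accepted iterations and $G_K$ the group obtained after the last of them.
   Formalization: It is additionally assumed that in every accepted iteration the maximum in (S3), taken of the real part of the Frobenius inner product, is strictly positive; without this the rounded permutation may already lie in G_k and the bound fails (e.g. M=2, R=I, B={diag(1,-1)}). *)

theory Defs
  imports
    "HOL-Analysis.Analysis"
    "HOL-Algebra.Bij"
    "HOL-Algebra.Generated_Groups"
    "HOL-Library.Landau_Symbols"
begin

text \<open>
  Matrices in \<open>\<complex>\<^sup>M\<^sup>\<times>\<^sup>M\<close> are elements of \<^typ>\<open>complex^'n^'n\<close> with \<open>M = CARD('n)\<close>.
  The library norm on this type is the root of the sum of the squared moduli of the entries,
  that is, the Frobenius norm; see \<open>norm_eq_frobenius\<close> below.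
\<close>

definition ctranspose :: "complex^'n^'n \<Rightarrow> complex^'n^'n" where
  "ctranspose A = (\<chi> i j. cnj (A $ j $ i))"

definition hermitian :: "complex^'n^'n \<Rightarrow> bool" where
  "hermitian A \<longleftrightarrow> ctranspose A = A"

definition finner :: "complex^'n^'n \<Rightarrow> complex^'n^'n \<Rightarrow> complex" where
  "finner X Y = trace (ctranspose X ** Y)"

lemma finner_eq_sum: "finner X Y = (\<Sum>j\<in>UNIV. \<Sum>i\<in>UNIV. cnj (X $ i $ j) * Y $ i $ j)"
  by (simp add: finner_def trace_def ctranspose_def matrix_matrix_mult_def)

lemma norm_eq_frobenius: "complex_of_real ((norm A)\<^sup>2) = finner A A"
proof -
  have "(norm A)\<^sup>2 = (\<Sum>i\<in>UNIV. \<Sum>j\<in>UNIV. (cmod (A $ i $ j))\<^sup>2)"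
    by (simp add: norm_vec_def L2_set_def sum_nonneg)
  also have "\<dots> = (\<Sum>j\<in>UNIV. \<Sum>i\<in>UNIV. (cmod (A $ i $ j))\<^sup>2)"
    by (rule sum.swap)
  also have "complex_of_real \<dots> = finner A A"
    by (simp add: finner_eq_sum complex_norm_square mult.commute del: of_real_power)
  finally show ?thesis .
qed

definition commutator :: "complex^'n^'n \<Rightarrow> complex^'n^'n \<Rightarrow> complex^'n^'n" where
  "commutator X Y = X ** Y - Y ** X"

definition delta :: "complex^'n^'n \<Rightarrow> complex^'n^'n \<Rightarrow> real" where
  "delta A R = norm (commutator R A) / (norm R * norm A)"

text \<open>
  The library provides only the real vector space structure on \<^typ>\<open>complex^'n^'n\<close>; spans
  are taken over the complex numbers.
\<close>

definition cscale :: "complex \<Rightarrow> complex^'n^'n \<Rightarrow> complex^'n^'n" where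
  "cscale c A = (\<chi> i j. c * A $ i $ j)"

interpretation cmat: vector_space cscale
  by unfold_locales (simp_all add: cscale_def vec_eq_iff algebra_simps)

abbreviation Sym :: "('n \<Rightarrow> 'n) monoid" where
  "Sym \<equiv> BijGroup UNIV"

definition perm_mat :: "('n \<Rightarrow> 'n) \<Rightarrow> complex^'n^'n" where
  "perm_mat \<sigma> = (\<chi> i j. if i = \<sigma> j then 1 else 0)"

definition deflated :: "(complex^'n^'n) set \<Rightarrow> ('n \<Rightarrow> 'n) set \<Rightarrow> (complex^'n^'n) set" where
  "deflated \<B> G =
     {A \<in> cmat.span \<B>. \<forall>X \<in> cmat.span (perm_mat ` G). finner X A = 0}"

definition optimal_generator ::
  "complex^'n^'n \<Rightarrow> (complex^'n^'n) set \<Rightarrow> ('n \<Rightarrow> 'n) set \<Rightarrow> complex^'n^'n \<Rightarrow> bool" where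
  "optimal_generator R \<B> G A \<longleftrightarrow>
     norm A = 1 \<and>
     is_arg_min (\<lambda>X. (norm (commutator R X))\<^sup>2 / (norm X)\<^sup>2) (\<lambda>X. X \<in> deflated \<B> G \<and> X \<noteq> 0) A"

text \<open>
  The Frobenius inner product is complex valued, and it is its real part that a nearest
  permutation maximizes, because
  \<open>\<parallel>A - P\<^sub>\<sigma>\<parallel>\<^sup>2 = \<parallel>A\<parallel>\<^sup>2 + M - 2 Re \<langle>A, P\<^sub>\<sigma>\<rangle>\<close>.
  Any maximizer may be chosen.
\<close>

definition rounding :: "complex^'n^'n \<Rightarrow> ('n \<Rightarrow> 'n) \<Rightarrow> bool" where
  "rounding A \<sigma> \<longleftrightarrow> is_arg_max (\<lambda>\<rho>. Re (finner A (perm_mat \<rho>))) (\<lambda>\<rho>. \<rho> \<in> carrier Sym) \<sigma>"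

text \<open>
  A complete run with exactly \<open>K\<close> accepted iterations. \<open>G k\<close> is the group after \<open>k\<close> accepted
  iterations; \<open>A (Suc k)\<close> and \<open>\<sigma> (Suc k)\<close> are the minimizer and the permutation computed
  from \<open>G k\<close>. The cap is tested only after an acceptance, so the first iteration is always
  attempted. The run ends because the cap is reached, because the next permutation is rejected,
  or because there is no nonzero candidate left to minimize over.
\<close>

definition deflation_run ::
  "complex^'n^'n \<Rightarrow> (complex^'n^'n) set \<Rightarrow> real \<Rightarrow> nat \<Rightarrow> nat \<Rightarrow>
   (nat \<Rightarrow> complex^'n^'n) \<Rightarrow> (nat \<Rightarrow> 'n \<Rightarrow> 'n) \<Rightarrow> (nat \<Rightarrow> ('n \<Rightarrow> 'n) set) \<Rightarrow> bool" where
  "deflation_run R \<B> \<tau> Kmax K A \<sigma> G \<longleftrightarrow>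
     G 0 = {\<one>\<^bsub>Sym\<^esub>} \<and>
     (\<forall>k<K. (k = 0 \<or> k < Kmax) \<and>
        optimal_generator R \<B> (G k) (A (Suc k)) \<and>
        rounding (A (Suc k)) (\<sigma> (Suc k)) \<and>
        delta (perm_mat (\<sigma> (Suc k))) R \<le> \<tau> \<and>
        G (Suc k) = generate Sym (insert (\<sigma> (Suc k)) (G k))) \<and>
     (0 < K \<and> Kmax \<le> K \<or>
      optimal_generator R \<B> (G K) (A (Suc K)) \<and>
        rounding (A (Suc K)) (\<sigma> (Suc K)) \<and>
        delta (perm_mat (\<sigma> (Suc K))) R > \<tau> \<or>
      deflated \<B> (G K) \<subseteq> {0})"

end

theory Submission
  imports Defs
begin

text \<open>
  Every matrix of the deflated space is orthogonal to all \<open>P\<^sub>g\<close> with \<open>g\<close> in the current group,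
  while the rounded permutation has positive overlap with it; hence it lies outside the group.
  A proper extension of a finite group at least doubles the order (Lagrange), so
  \<open>2\<^sup>K \<le> |G\<^sub>K| \<le> M!\<close>.
\<close>

text \<open>The right coset of \<open>H\<close> by \<open>a\<close> lies in \<open>K\<close>, is as
  large as \<open>H\<close> by cancellation, and misses \<open>H\<close> because \<open>a\<close>
  does; so \<open>K\<close> contains two disjoint sets of size \<open>card H\<close>.\<close>

lemma (in group) card_proper_subgroup_double:
  assumes "subgroup H G" "subgroup K G" "H \<subseteq> K" "finite K" "a \<in> K" "a \<notin> H"
  shows "2 * card H \<le> card K"
proof -
  have H: "H \<subseteq> carrier G" and a: "a \<in> carrier G"
    using assms subgroup.subset by blast+
  have fin: "finite H"
    using assms(3,4) by (rule finite_subset)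
  have inj: "inj_on (\<lambda>h. h \<otimes> a) H"
    using H a by (intro inj_onI) (metis right_cancel subsetD)
  have disj: "H \<inter> (\<lambda>h. h \<otimes> a) ` H = {}"
  proof (rule ccontr)
    assume "H \<inter> (\<lambda>h. h \<otimes> a) ` H \<noteq> {}"
    then obtain h where h: "h \<in> H" "h \<otimes> a \<in> H" by auto
    then have "inv h \<otimes> (h \<otimes> a) \<in> H"
      using assms(1) by (simp add: subgroup.m_closed subgroup.m_inv_closed)
    moreover have "inv h \<otimes> (h \<otimes> a) = a"
      using h H a by (simp add: m_assoc [symmetric] subsetD)
    ultimately show False using assms(6) by simp
  qed
  have "2 * card H = card (H \<union> (\<lambda>h. h \<otimes> a) ` H)"
    using fin disj inj by (simp add: card_Un_disjoint card_image)
  also have "\<dots> \<le> card K"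
    using assms by (intro card_mono) (auto intro: subgroup.m_closed)
  finally show ?thesis .
qed

lemma cnj_finner: "cnj (finner X Y) = finner Y X"
  by (simp add: finner_eq_sum mult.commute)

text \<open>Members of \<open>G\<close> have overlap 0 with \<open>A\<close>, so none of them can
  attain a maximum that is positive.\<close>

lemma rounding_notin_group:
  assumes A: "A \<in> deflated \<B> G"
    and rnd: "rounding A \<sigma>"
    and overlap: "\<rho> \<in> carrier Sym" "0 < Re (finner A (perm_mat \<rho>))"
  shows "\<sigma> \<notin> G"
proof
  assume "\<sigma> \<in> G"
  then have "finner (perm_mat \<sigma>) A = 0"
    using A by (simp add: deflated_def cmat.span_base)
  \<comment> \<open>\<open>deflated\<close> has the permutation in the first slot of
    \<open>finner\<close>, \<open>rounding\<close> in the second; the two values are conjugate, so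
    both vanish.\<close>
  then have "Re (finner A (perm_mat \<sigma>)) = 0"
    using cnj_finner [of "perm_mat \<sigma>" A] by simp
  moreover have "Re (finner A (perm_mat \<rho>)) \<le> Re (finner A (perm_mat \<sigma>))"
    using rnd overlap(1) by (auto simp: rounding_def is_arg_max_linorder)
  ultimately show False using overlap(2) by simp
qed

lemma carrier_Sym: "carrier (Sym :: ('n \<Rightarrow> 'n) monoid) = {p. p permutes UNIV}"
  by (auto simp: BijGroup_def Bij_def bij_iff permutes_univ)

lemma card_carrier_Sym: "card (carrier (Sym :: ('n::finite \<Rightarrow> 'n) monoid)) = fact CARD('n)"
  by (simp add: carrier_Sym card_permutations)

text \<open>The subgroup property is carried through the induction because the doubling step needs
  it for both \<open>G k\<close> and \<open>G (Suc k)\<close>.\<close>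

lemma deflation_run_group_order:
  assumes run: "deflation_run R \<B> \<tau> Kmax K A \<sigma> G"
    and overlap: "\<And>k. k < K \<Longrightarrow> \<exists>\<rho> \<in> carrier Sym. 0 < Re (finner (A (Suc k)) (perm_mat \<rho>))"
    and "k \<le> K"
  shows "subgroup (G k) Sym \<and> 2 ^ k \<le> card (G k)"
  using \<open>k \<le> K\<close>
proof (induction k)
  case 0
  have "G 0 = {\<one>\<^bsub>Sym\<^esub>}"
    using run by (simp add: deflation_run_def)
  then show ?case
    by (simp add: group.triv_subgroup [OF group_BijGroup])
next
  case (Suc k)
  interpret group "Sym :: ('a \<Rightarrow> 'a) monoid"
    by (rule group_BijGroup)
  have k: "k < K" using Suc.prems by simp
  have opt: "optimal_generator R \<B> (G k) (A (Suc k))"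
    and rnd: "rounding (A (Suc k)) (\<sigma> (Suc k))"
    and step: "G (Suc k) = generate Sym (insert (\<sigma> (Suc k)) (G k))"
    using run k by (auto simp: deflation_run_def)
  have sub: "subgroup (G k) Sym" and card: "2 ^ k \<le> card (G k)"
    using Suc k by auto
  have "A (Suc k) \<in> deflated \<B> (G k)"
    using opt by (simp add: optimal_generator_def is_arg_min_def)
  then have notin: "\<sigma> (Suc k) \<notin> G k"
    using rounding_notin_group rnd overlap [OF k] by blast
  have gens: "insert (\<sigma> (Suc k)) (G k) \<subseteq> carrier Sym"
    using rnd subgroup.subset [OF sub] by (simp add: rounding_def is_arg_max_def)
  then have sub': "subgroup (G (Suc k)) Sym"
    unfolding step by (rule generate_is_subgroup)
  have "insert (\<sigma> (Suc k)) (G k) \<subseteq> G (Suc k)"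
    unfolding step by (auto intro: generate.incl)
  then have "2 * card (G k) \<le> card (G (Suc k))"
    using card_proper_subgroup_double [OF sub sub' _ _ _ notin] by simp
  then show ?case using sub' card by simp
qed

text \<open>The crude bound M! \<le> M^M suffices. It yields the constant \<open>1 / ln 2\<close>;
  the added 1 pays for the ceiling, since M ln M \<ge> 1 eventually.\<close>

lemma ceiling_log_fact_bigo:
  "(\<lambda>M::nat. real_of_int \<lceil>log 2 (fact M)\<rceil>) \<in> O(\<lambda>M. real M * ln (real M))"
proof (rule bigoI)
  show "\<forall>\<^sub>F M::nat in sequentially.
    norm (real_of_int \<lceil>log 2 (fact M)\<rceil>) \<le> (1 / ln 2 + 1) * norm (real M * ln (real M))"
    \<comment> \<open>As e \<le> 3, this threshold ensures ln M \<ge> 1.\<close>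
    using eventually_ge_at_top [of 3]
  proof eventually_elim
    case (elim M)
    have "exp 1 \<le> real M"
      using exp_le elim by linarith
    then have "1 \<le> ln (real M)"
      using elim by (simp add: ln_ge_iff)
    then have one: "1 \<le> real M * ln (real M)"
      using elim mult_mono [of 1 "real M" 1 "ln (real M)"] by simp
    have "(fact M :: real) \<le> real M ^ M"
      using fact_le_power [of M] by simp
    then have "log 2 (fact M) \<le> log 2 (real M ^ M)"
      using elim by (subst log_le_cancel_iff) auto
    also have "\<dots> = 1 / ln 2 * (real M * ln (real M))"
      using elim by (simp add: log_def ln_realpow)
    finally have "log 2 (fact M) \<le> 1 / ln 2 * (real M * ln (real M))" .
    then have upper: "real_of_int \<lceil>log 2 (fact M)\<rceil> \<le> (1 / ln 2 + 1) * (real M * ln (real M))"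
      using one of_int_ceiling_le_add_one [of "log 2 (fact M)"] by (simp only: distrib_right)
    \<comment> \<open>Nonnegativity lets the norm around the ceiling be dropped.\<close>
    have "0 \<le> log 2 (fact M)"
      by (simp add: fact_ge_1)
    then have "0 \<le> real_of_int \<lceil>log 2 (fact M)\<rceil>"
      by linarith
    with upper one show ?case by simp
  qed
qed

text \<open>\<open>positive_overlap\<close> concerns accepted iterations only and rules out
  stalling. For M = 2 and \<B> = {diag(1,-1)}, the normalized generator is orthogonal to both
  permutation matrices; rounding may return the identity, which is accepted with
  \<open>delta\<close> equal to 0 and leaves the group trivial.\<close>

theorem corollary11p4:
  fixes R :: "complex^'n^'n"
    and \<B> :: "(complex^'n^'n) set"
    and \<tau> :: real
    and Kmax K :: nat
    and A :: "nat \<Rightarrow> complex^'n^'n"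
    and \<sigma> :: "nat \<Rightarrow> 'n \<Rightarrow> 'n"
    and G :: "nat \<Rightarrow> ('n \<Rightarrow> 'n) set"
  assumes "hermitian R"
    and "finite \<B>"
    and "0 \<le> \<tau>"
    and run: "deflation_run R \<B> \<tau> Kmax K A \<sigma> G"
    and positive_overlap:
      "\<And>k. k < K \<Longrightarrow> \<exists>\<rho> \<in> carrier Sym. 0 < Re (finner (A (Suc k)) (perm_mat \<rho>))"
  shows "int K \<le> \<lceil>log 2 (real (card (G K)))\<rceil>
    \<and> int K \<le> \<lceil>log 2 (fact CARD('n))\<rceil>
    \<and> (\<lambda>M::nat. real_of_int \<lceil>log 2 (fact M)\<rceil>) \<in> O(\<lambda>M. real M * ln (real M))"
proof (intro conjI ceiling_log_fact_bigo)
  have sub: "subgroup (G K) Sym" and "2 ^ K \<le> card (G K)"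
    using deflation_run_group_order [OF run positive_overlap] by auto
  then have "(2::real) ^ K \<le> real (card (G K))"
    by (metis of_nat_le_iff of_nat_numeral of_nat_power)
  then have K: "real K \<le> log 2 (real (card (G K)))"
    by (simp add: le_log2_of_power)
  then show "int K \<le> \<lceil>log 2 (real (card (G K)))\<rceil>"
    by linarith
  have "card (G K) \<le> fact CARD('n)"
    using subgroup.subset [OF sub] card_mono [OF finite]
    by (simp flip: card_carrier_Sym)
  then have "real (card (G K)) \<le> fact CARD('n)"
    by (metis of_nat_fact of_nat_le_iff)
  \<comment> \<open>Monotonicity of \<open>log\<close> is available only for positive
    arguments.\<close>
  moreover have "0 < real (card (G K))"
    using \<open>(2::real) ^ K \<le> real (card (G K))\<close> by (rule less_le_trans [rotated]) simp
  ultimately have "log 2 (real (card (G K))) \<le> log 2 (fact CARD('n))"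
    by (subst log_le_cancel_iff) auto
  with K show "int K \<le> \<lceil>log 2 (fact CARD('n))\<rceil>"
    by linarith
qed

end
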